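(* There is an absolute constant $c>0$ such that for every $\gamma>0$, every integer $N\ge1$, and all $G,R>0$ the following holds. Let $d=1$ if $\gamma\in(0,\frac14]$, and $d=\max\{\lceil 16N^{1-2\gamma}\rceil,1\}$ if $\gamma>\frac14$. Then there exist a nonempty closed convex set $X\subseteq\mathbb{R}^d$, a convex function $f:\mathbb{R}^d\to\mathbb{R}$ with a minimizer $x^*\in\operatorname{argmin}_{x\in X}f(x)$ and with $\|g\|\le G$ for all $x\in X$, $g\in\partial f(x)$, a starting point $x^1\in X$ with $\|x^1-x^*\|\le R$, and a run of $N$ iterations of AdaGrad from $x^1$ with parameter $h=R/N^{\gamma}$ (i.e. an admissible choice of subgradients $g^k\in\partial f(x^k)$, $k=1,\dots,N$) whose last iterate satisfies $$f(x^{N+1})-f(x^* )\ge c\,\max\left\{\frac{GR}{N^{\gamma}},\ \min\left\{\frac{GR}{N^{\frac12-\gamma}},\,GR\right\}\right\}.$$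
   Context: $\|\cdot\|$ is the Euclidean norm on $\mathbb{R}^d$, $\partial f(x)=\{g\in\mathbb{R}^d: f(y)\ge f(x)+\langle g,y-x\rangle\ \forall y\in\mathbb{R}^d\}$, and $P_X(y)=\operatorname{argmin}_{x\in X}\|x-y\|$ is the Euclidean projection onto $X$. AdaGrad (scalar stepsizes) with parameter $h>0$, run for $N$ iterations from $x^1\in X$: for $k=1,\dots,N$, receive some (arbitrarily selected) $g^k\in\partial f(x^k)$ and set $$x^{k+1}=P_X(x^k-h_kg^k),\qquad h_k=\frac{h}{\sqrt{G^2+\sum_{i=1}^{k}\|g^i\|^2}}.$$ The last iterate is $x^{N+1}$. *)

theory Defs
  imports "HOL-Analysis.Analysis" "HOL-Library.Function_Algebras"
begin

(* The dimension d depends on the other parameters, so it cannot be a type. R^d is therefore the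
   library's topspace (Euclidean_space d), the functions nat => real vanishing at all indices
   >= d (coordinates 0, ..., d - 1), with the topology Euclidean_space d. Its vector space
   structure is pointwise; the instance below makes the library's convex and convex_on
   available for it. *)

instantiation "fun" :: (type, real_vector) real_vector
begin

definition scaleR_fun :: "real \<Rightarrow> ('a \<Rightarrow> 'b) \<Rightarrow> 'a \<Rightarrow> 'b"
  where "scaleR_fun a x = (\<lambda>i. a *\<^sub>R x i)"

instance
  by standard (auto simp: scaleR_fun_def fun_eq_iff scaleR_add_right scaleR_add_left)

end

abbreviation Rn :: "nat \<Rightarrow> (nat \<Rightarrow> real) set"
  where "Rn d \<equiv> topspace (Euclidean_space d)"

definition inner_Rn :: "nat \<Rightarrow> (nat \<Rightarrow> real) \<Rightarrow> (nat \<Rightarrow> real) \<Rightarrow> real"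
  where "inner_Rn d x y = (\<Sum>i<d. x i * y i)"

definition norm_Rn :: "nat \<Rightarrow> (nat \<Rightarrow> real) \<Rightarrow> real"
  where "norm_Rn d x = L2_set x {..<d}"

definition subdifferential :: "nat \<Rightarrow> ((nat \<Rightarrow> real) \<Rightarrow> real) \<Rightarrow> (nat \<Rightarrow> real) \<Rightarrow> (nat \<Rightarrow> real) set"
  where "subdifferential d f x = {g \<in> Rn d. \<forall>y\<in>Rn d. f y \<ge> f x + inner_Rn d g (y - x)}"

(* As a choice of minimizer this is the Euclidean projection only for nonempty closed convex X,
   where the minimizer exists and is unique. *)
definition proj_Rn :: "nat \<Rightarrow> (nat \<Rightarrow> real) set \<Rightarrow> (nat \<Rightarrow> real) \<Rightarrow> (nat \<Rightarrow> real)"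
  where "proj_Rn d X y = arg_min_on (\<lambda>x. norm_Rn d (x - y)) X"

definition adagrad_step :: "nat \<Rightarrow> real \<Rightarrow> real \<Rightarrow> (nat \<Rightarrow> nat \<Rightarrow> real) \<Rightarrow> nat \<Rightarrow> real"
  where "adagrad_step d G h g k = h / sqrt (G\<^sup>2 + (\<Sum>i = 1..k. (norm_Rn d (g i))\<^sup>2))"

(* Only x 1, ..., x (N + 1) and g 1, ..., g N are constrained. *)
definition adagrad_run ::
  "nat \<Rightarrow> (nat \<Rightarrow> real) set \<Rightarrow> ((nat \<Rightarrow> real) \<Rightarrow> real) \<Rightarrow> real \<Rightarrow> real \<Rightarrow> nat \<Rightarrow>
    (nat \<Rightarrow> nat \<Rightarrow> real) \<Rightarrow> (nat \<Rightarrow> nat \<Rightarrow> real) \<Rightarrow> bool"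
  where "adagrad_run d X f G h N x g \<longleftrightarrow>
    x 1 \<in> X \<and>
    (\<forall>k\<in>{1..N}. g k \<in> subdifferential d f (x k) \<and>
       x (k + 1) = proj_Rn d X (x k - adagrad_step d G h g k *\<^sub>R g k))"

definition lower_bound_dim :: "real \<Rightarrow> nat \<Rightarrow> nat"
  where "lower_bound_dim \<gamma> N =
    (if \<gamma> \<le> 1 / 4 then 1 else nat (max \<lceil>16 * real N powr (1 - 2 * \<gamma>)\<rceil> 1))"

end

theory Submission
  imports Defs
begin

text \<open>
  One function suffices for every \<open>\<gamma>\<close>: a multiple \<open>G\<close> of the maximum norm on the whole space.
  It is \<open>G\<close>-Lipschitz, so its subgradients have norm at most \<open>G\<close>, its minimizer is the origin, and
  the absence of constraints makes the projection the identity. Two runs produce the two terms of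
  the bound.

  For \<open>\<gamma> \<le> 1/4\<close> the term \<open>G R / N\<^sup>\<gamma> = G h\<close> dominates. The run starts at the minimizer and receives
  zero subgradients until the last iteration, so the accumulated sum in the stepsize stays empty.
  The last subgradient is a coordinate vector of length \<open>G\<close>, and the step of length
  \<open>h / sqrt 2\<close> taken along it is never corrected (\<open>late_kick_run\<close>).

  For \<open>\<gamma> > 1/4\<close> the steps are too short for the dimension. The run starts at the point with all
  coordinates \<open>R / sqrt d\<close>, and every subgradient is plus or minus \<open>G\<close> times one coordinate vector.
  Step number \<open>k\<close> therefore moves a single coordinate by \<open>h / sqrt (k + 1)\<close>, and all steps together
  lower the sum of the coordinates by at most \<open>2 h sqrt N\<close>. That sum is \<open>R sqrt d\<close> initially,
  and \<open>d \<ge> 16 N powr (1 - 2 \<gamma>)\<close> amounts to \<open>2 h sqrt N \<le> R sqrt d / 2\<close>; hence at the end the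
  average coordinate, and with it the maximum norm, is still at least \<open>R / (2 sqrt d)\<close>
  (\<open>coordinate_run\<close>). Since \<open>sqrt d \<le> 5 max (N powr (1/2 - \<gamma>)) 1\<close>, \<open>G\<close> times this is at
  least a tenth of the minimum in the bound, which is the dominating term here.
\<close>

definition max_norm :: "nat \<Rightarrow> (nat \<Rightarrow> real) \<Rightarrow> real"
  where "max_norm d x = Max ((\<lambda>i. \<bar>x i\<bar>) ` {..<d})"

definition coord_vec :: "nat \<Rightarrow> real \<Rightarrow> nat \<Rightarrow> real"
  where "coord_vec i c = (\<lambda>j. if j = i then c else 0)"

lemma Rn_iff: "x \<in> Rn d \<longleftrightarrow> (\<forall>i\<ge>d. x i = 0)"
  by (auto simp: topspace_Euclidean_space)

lemma Rn_add: "x \<in> Rn d \<Longrightarrow> y \<in> Rn d \<Longrightarrow> x + y \<in> Rn d"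
  and Rn_diff: "x \<in> Rn d \<Longrightarrow> y \<in> Rn d \<Longrightarrow> x - y \<in> Rn d"
  and Rn_scaleR: "x \<in> Rn d \<Longrightarrow> a *\<^sub>R x \<in> Rn d"
  and Rn_zero: "0 \<in> Rn d"
  by (auto simp: Rn_iff scaleR_fun_def)

lemma Rn_coord_vec: "i < d \<Longrightarrow> coord_vec i c \<in> Rn d"
  by (auto simp: Rn_iff coord_vec_def)

lemma convex_Rn: "convex (Rn d)"
  by (auto simp: convex_def intro!: Rn_add Rn_scaleR)

section \<open>The maximum norm\<close>

lemma abs_le_max_norm: "i < d \<Longrightarrow> \<bar>x i\<bar> \<le> max_norm d x"
  by (auto simp: max_norm_def intro!: Max_ge)

lemma max_norm_leI:
  assumes "d \<ge> 1" "\<And>i. i < d \<Longrightarrow> \<bar>x i\<bar> \<le> c"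
  shows "max_norm d x \<le> c"
  using assms by (auto simp: max_norm_def lessThan_empty_iff)

lemma max_norm_attained:
  assumes "d \<ge> 1"
  obtains i where "i < d" "\<bar>x i\<bar> = max_norm d x"
proof -
  have "max_norm d x \<in> (\<lambda>i. \<bar>x i\<bar>) ` {..<d}"
    unfolding max_norm_def using assms by (intro Max_in) (auto simp: lessThan_empty_iff)
  then show ?thesis using that by auto
qed

lemma max_norm_nonneg: "d \<ge> 1 \<Longrightarrow> 0 \<le> max_norm d x"
  using abs_le_max_norm[of 0 d x] by simp

lemma max_norm_zero: "d \<ge> 1 \<Longrightarrow> max_norm d 0 = 0"
  using max_norm_leI[of d 0 0] max_norm_nonneg[of d 0] by simp

lemma max_norm_triangle:
  assumes "d \<ge> 1"
  shows "max_norm d (x + y) \<le> max_norm d x + max_norm d y"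
proof (rule max_norm_leI[OF assms])
  fix i assume "i < d"
  then show "\<bar>(x + y) i\<bar> \<le> max_norm d x + max_norm d y"
    using abs_le_max_norm[of i d x] abs_le_max_norm[of i d y] by simp
qed

lemma max_norm_scaleR_le:
  assumes "d \<ge> 1" "a \<ge> 0"
  shows "max_norm d (a *\<^sub>R x) \<le> a * max_norm d x"
proof (rule max_norm_leI[OF assms(1)])
  fix i assume "i < d"
  then show "\<bar>(a *\<^sub>R x) i\<bar> \<le> a * max_norm d x"
    using assms(2) abs_le_max_norm[of i d x]
    by (auto simp: scaleR_fun_def abs_mult intro!: mult_left_mono)
qed

lemma max_norm_le_norm_Rn: "d \<ge> 1 \<Longrightarrow> max_norm d x \<le> norm_Rn d x"
proof (rule max_norm_leI)
  fix i assume "i < d"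
  then have "\<bar>x i\<bar> \<le> L2_set (\<lambda>j. \<bar>x j\<bar>) {..<d}"
    by (intro member_le_L2_set) auto
  then show "\<bar>x i\<bar> \<le> norm_Rn d x"
    by (simp add: norm_Rn_def L2_set_def)
qed

lemma sum_le_max_norm: "(\<Sum>i<d. x i) \<le> real d * max_norm d x"
  using sum_bounded_above[of "{..<d}" x "max_norm d x"] abs_le_max_norm[of _ d x]
  by (auto simp: abs_le_iff)

lemma convex_on_max_norm:
  assumes "d \<ge> 1" "G \<ge> 0"
  shows "convex_on (Rn d) (\<lambda>x. G * max_norm d x)"
proof (rule convex_onI[OF _ convex_Rn])
  fix t x y assume t: "(0::real) < t" "t < 1"
  have "max_norm d ((1 - t) *\<^sub>R x + t *\<^sub>R y) \<le> (1 - t) * max_norm d x + t * max_norm d y"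
    using max_norm_triangle[OF assms(1), of "(1 - t) *\<^sub>R x" "t *\<^sub>R y"]
      max_norm_scaleR_le[OF assms(1), of "1 - t" x] max_norm_scaleR_le[OF assms(1), of t y] t
    by linarith
  then have "G * max_norm d ((1 - t) *\<^sub>R x + t *\<^sub>R y)
      \<le> G * ((1 - t) * max_norm d x + t * max_norm d y)"
    using assms(2) by (rule mult_left_mono)
  then show "G * max_norm d ((1 - t) *\<^sub>R x + t *\<^sub>R y)
      \<le> (1 - t) * (G * max_norm d x) + t * (G * max_norm d y)"
    by (simp add: algebra_simps)
qed

lemma zero_is_arg_min:
  assumes "d \<ge> 1" "G \<ge> 0"
  shows "is_arg_min (\<lambda>x. G * max_norm d x) (\<lambda>z. z \<in> Rn d) 0"
proof -
  have "0 \<le> G * max_norm d x" for x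
    using assms max_norm_nonneg by simp
  then show ?thesis
    using assms Rn_zero by (auto simp: is_arg_min_def max_norm_zero not_less)
qed

section \<open>Subgradients of the maximum norm\<close>

text \<open>Test the subgradient inequality in the direction of the subgradient itself: there the
  function grows at most by \<open>G\<close> times the length, and at least by the square of the length.\<close>
lemma norm_subgradient_max_norm_le:
  assumes "d \<ge> 1" "G \<ge> 0" "z \<in> Rn d"
    and v: "v \<in> subdifferential d (\<lambda>x. G * max_norm d x) z"
  shows "norm_Rn d v \<le> G"
proof -
  let ?n = "norm_Rn d v"
  have sq: "inner_Rn d v v = ?n * ?n"
    by (simp add: inner_Rn_def norm_Rn_def L2_set_def power2_eq_square[symmetric] sum_nonneg)
  have "z + v \<in> Rn d"
    using v assms(3) by (auto simp: subdifferential_def intro: Rn_add)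
  then have "G * max_norm d z + ?n * ?n \<le> G * max_norm d (z + v)"
    using v sq unfolding subdifferential_def by fastforce
  also have "\<dots> \<le> G * (max_norm d z + ?n)"
    using max_norm_triangle[OF assms(1), of z v] max_norm_le_norm_Rn[OF assms(1), of v] assms(2)
    by (intro mult_left_mono) auto
  finally have "?n * ?n \<le> G * ?n"
    by (simp add: algebra_simps)
  then show ?thesis
    using assms(2) by (cases "?n > 0") auto
qed

text \<open>The parameter \<open>s\<close> is a subgradient of the absolute value at the coordinate of largest modulus.
  At the origin every \<open>s\<close> between \<open>-1\<close> and \<open>1\<close> qualifies, which gives both zero and a vector of
  length \<open>G\<close>.\<close>
lemma coord_vec_subgradient:
  assumes "d \<ge> 1" "G \<ge> 0" "i < d" "\<bar>x i\<bar> = max_norm d x" "\<bar>s\<bar> \<le> 1" "s * x i = \<bar>x i\<bar>"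
  shows "coord_vec i (G * s) \<in> subdifferential d (\<lambda>x. G * max_norm d x) x"
proof -
  have "G * max_norm d x + inner_Rn d (coord_vec i (G * s)) (y - x) \<le> G * max_norm d y" for y
  proof -
    have "inner_Rn d (coord_vec i (G * s)) (y - x) = G * s * (y i - x i)"
      using assms(3) by (simp add: inner_Rn_def coord_vec_def if_distrib[of "\<lambda>c. c * _"] cong: if_cong)
    then have "G * max_norm d x + inner_Rn d (coord_vec i (G * s)) (y - x)
        = G * (max_norm d x + s * y i - s * x i)"
      by (simp add: algebra_simps)
    also have "\<dots> = G * (s * y i)"
      using assms(4,6) by simp
    also have "\<dots> \<le> G * max_norm d y"
    proof (rule mult_left_mono[OF _ assms(2)])
      have "s * y i \<le> \<bar>s\<bar> * \<bar>y i\<bar>"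
        by (metis abs_ge_self abs_mult)
      also have "\<dots> \<le> 1 * \<bar>y i\<bar>"
        using assms(5) by (intro mult_right_mono) auto
      also have "\<dots> \<le> max_norm d y"
        using abs_le_max_norm[OF assms(3)] by simp
      finally show "s * y i \<le> max_norm d y" .
    qed
    finally show ?thesis .
  qed
  then show ?thesis
    using Rn_coord_vec[OF assms(3)] by (simp add: subdifferential_def)
qed

lemma norm_coord_vec: "i < d \<Longrightarrow> norm_Rn d (coord_vec i c) = \<bar>c\<bar>"
  by (simp add: norm_Rn_def L2_set_def coord_vec_def if_distrib[of "\<lambda>c. c\<^sup>2"] cong: if_cong)

section \<open>Unconstrained runs\<close>

lemma proj_Rn_whole_space:
  assumes "y \<in> Rn d"
  shows "proj_Rn d (Rn d) y = y"
proof -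
  have z: "norm_Rn d (y - y) = 0"
    by (simp add: norm_Rn_def L2_set_def)
  have nn: "0 \<le> norm_Rn d v" for v
    by (simp add: norm_Rn_def)
  have "z = y" if "is_arg_min (\<lambda>x. norm_Rn d (x - y)) (\<lambda>x. x \<in> Rn d) z" for z
  proof -
    have "norm_Rn d (z - y) = 0" "z \<in> Rn d"
      using that assms z nn[of "z - y"] by (force simp: is_arg_min_def)+
    then show ?thesis
      using assms by (intro ext, rename_tac i, case_tac "i < d")
        (auto simp: norm_Rn_def L2_set_eq_0_iff Rn_iff)
  qed
  moreover have "is_arg_min (\<lambda>x. norm_Rn d (x - y)) (\<lambda>x. x \<in> Rn d) y"
    using assms z nn by (auto simp: is_arg_min_def not_less)
  ultimately show ?thesis
    unfolding proj_Rn_def arg_min_on_def arg_min_def by (intro some_equality)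
qed

text \<open>Zero subgradients neither move the iterate nor enlarge the sum in the stepsize, so the only
  nonzero subgradient, at iteration \<open>N\<close>, meets the stepsize \<open>h / sqrt (2 G\<^sup>2)\<close>.\<close>
lemma late_kick_run:
  assumes "d \<ge> 1" "G > 0" "h > 0" "N \<ge> 1"
  obtains x g where "x 1 = 0" "adagrad_run d (Rn d) (\<lambda>x. G * max_norm d x) G h N x g"
    "G * h / sqrt 2 \<le> G * max_norm d (x (N + 1))"
proof
  define g where "g k = (if k = N then coord_vec 0 G else 0)" for k
  define x where "x k = (if k \<le> N then 0 else - (h / (G * sqrt 2)) *\<^sub>R coord_vec 0 G)" for k
  have sub: "coord_vec 0 (G * s) \<in> subdifferential d (\<lambda>x. G * max_norm d x) 0" if "\<bar>s\<bar> \<le> 1" for s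
    using coord_vec_subgradient[of d G 0 0 s] assms that by (simp add: max_norm_zero)
  have zero: "coord_vec 0 0 = 0"
    by (auto simp: coord_vec_def)
  have norm_g: "norm_Rn d (g k) = (if k = N then G else 0)" for k
    using norm_coord_vec[of 0 d G] norm_coord_vec[of 0 d 0] assms by (simp add: g_def zero)
  have stepN: "adagrad_step d G h g N = h / (G * sqrt 2)"
  proof -
    have "(\<Sum>i = 1..N. (norm_Rn d (g i))\<^sup>2) = G\<^sup>2"
      using assms(4) by (simp add: norm_g if_distrib[of "\<lambda>c. c\<^sup>2"] cong: if_cong)
    then have "adagrad_step d G h g N = h / sqrt (2 * G\<^sup>2)"
      by (simp add: adagrad_step_def)
    then show ?thesis
      using assms(2) by (simp add: real_sqrt_mult mult.commute)
  qed
  show "x 1 = 0"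
    using assms(4) by (simp add: x_def)
  show "adagrad_run d (Rn d) (\<lambda>x. G * max_norm d x) G h N x g"
    unfolding adagrad_run_def
  proof (intro conjI ballI)
    show "x 1 \<in> Rn d"
      using assms(4) Rn_zero by (simp add: x_def)
    fix k assume k: "k \<in> {1..N}"
    show "g k \<in> subdifferential d (\<lambda>x. G * max_norm d x) (x k)"
      using k sub[of 1] sub[of 0] by (simp add: g_def x_def zero)
    have "x k - adagrad_step d G h g k *\<^sub>R g k = x (k + 1)"
      using k stepN by (cases "k = N") (auto simp: x_def g_def)
    moreover have "x (k + 1) \<in> Rn d"
      using assms(1) by (simp add: x_def Rn_zero Rn_scaleR Rn_coord_vec del: scaleR_minus_left)
    ultimately show "x (k + 1) = proj_Rn d (Rn d) (x k - adagrad_step d G h g k *\<^sub>R g k)"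
      by (simp add: proj_Rn_whole_space)
  qed
  have "\<bar>x (N + 1) 0\<bar> = h / sqrt 2"
    using assms by (simp add: x_def scaleR_fun_def coord_vec_def)
  then have "h / sqrt 2 \<le> max_norm d (x (N + 1))"
    using abs_le_max_norm[of 0 d "x (N + 1)"] assms(1) by simp
  then show "G * h / sqrt 2 \<le> G * max_norm d (x (N + 1))"
    using mult_left_mono[of _ _ G] assms(2) by fastforce
qed

lemma sqrt_increment_ge: "1 / sqrt (real n + 2) \<le> 2 * sqrt (real n + 1) - 2 * sqrt (real n)"
proof -
  let ?a = "sqrt (real n + 1)" and ?b = "sqrt (real n)"
  have "1 = (?a - ?b) * (?a + ?b)"
    by (simp add: algebra_simps)
  also have "\<dots> \<le> (?a - ?b) * (2 * ?a)"
    by (intro mult_left_mono) auto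
  finally have "1 \<le> (2 * ?a - 2 * ?b) * ?a"
    by (simp add: algebra_simps)
  then have "1 / ?a \<le> 2 * ?a - 2 * ?b"
    by (subst pos_divide_le_eq) auto
  moreover have "1 / sqrt (real n + 2) \<le> 1 / ?a"
    by (intro divide_left_mono) auto
  ultimately show ?thesis by linarith
qed

text \<open>All subgradients of the run have length exactly \<open>G\<close>, so the stepsizes do not depend on which
  coordinates are chosen. What makes the argument insensitive to the choice is that the sum of all
  coordinates drops by at most \<open>h / sqrt (k + 1)\<close> in step \<open>k\<close>, whichever coordinate moves.\<close>
lemma coordinate_run:
  assumes "d \<ge> 1" "G > 0" "h > 0" "x1 \<in> Rn d"
  obtains x g where "x 1 = x1" "adagrad_run d (Rn d) (\<lambda>x. G * max_norm d x) G h N x g"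
    "(\<Sum>i<d. x1 i) - 2 * h * sqrt (real N) \<le> real d * max_norm d (x (N + 1))"
proof -
  have "\<exists>v\<in>subdifferential d (\<lambda>x. G * max_norm d x) y. \<exists>i<d. \<exists>s. \<bar>s\<bar> = 1 \<and> v = coord_vec i (G * s)"
    for y
  proof -
    obtain i where i: "i < d" "\<bar>y i\<bar> = max_norm d y"
      using max_norm_attained[OF assms(1)] .
    (* The sign at zero is set to 1 so that the subgradient has length G there too. *)
    define s :: real where "s = (if y i \<ge> 0 then 1 else -1)"
    have "coord_vec i (G * s) \<in> subdifferential d (\<lambda>x. G * max_norm d x) y"
      using assms i by (intro coord_vec_subgradient) (auto simp: s_def)
    moreover have "\<bar>s\<bar> = 1"
      by (simp add: s_def)
    ultimately show ?thesis
      using i by blast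
  qed
  then obtain \<sigma> where \<sigma>: "\<And>y. \<sigma> y \<in> subdifferential d (\<lambda>x. G * max_norm d x) y"
    "\<And>y. \<exists>i<d. \<exists>s. \<bar>s\<bar> = 1 \<and> \<sigma> y = coord_vec i (G * s)"
    by metis
  have norm_\<sigma>: "norm_Rn d (\<sigma> y) = G" for y
  proof -
    obtain i s where "i < d" "\<bar>s\<bar> = 1" "\<sigma> y = coord_vec i (G * s)"
      using \<sigma>(2) by blast
    then show ?thesis
      using norm_coord_vec assms(2) by (simp add: abs_mult)
  qed
  have sum_\<sigma>: "(\<Sum>i<d. \<sigma> y i) \<le> G" for y
  proof -
    obtain i s where i: "i < d" "\<bar>s\<bar> = 1" "\<sigma> y = coord_vec i (G * s)"
      using \<sigma>(2) by blast
    then have "(\<Sum>i<d. \<sigma> y i) = G * s"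
      by (simp add: coord_vec_def)
    also have "\<dots> \<le> G * 1"
      using i(2) assms(2) by (intro mult_left_mono) auto
    finally show ?thesis by simp
  qed
  have \<sigma>_Rn: "\<sigma> y \<in> Rn d" for y
    using \<sigma>(1)[of y] by (simp add: subdifferential_def)
  (* p n is the iterate number n + 1, hence the shift from k + 1 to n + 2 under the root. *)
  define p where "p = rec_nat x1 (\<lambda>n y. y - (h / (G * sqrt (real n + 2))) *\<^sub>R \<sigma> y)"
  have p0: "p 0 = x1"
    and pS: "p (Suc n) = p n - (h / (G * sqrt (real n + 2))) *\<^sub>R \<sigma> (p n)" for n
    by (simp_all add: p_def)
  have p_Rn: "p n \<in> Rn d" for n
    by (induction n) (simp_all only: p0 pS assms(4) Rn_diff Rn_scaleR \<sigma>_Rn)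
  have sum_p: "(\<Sum>i<d. x1 i) - 2 * h * sqrt (real n) \<le> (\<Sum>i<d. p n i)" for n
  proof (induction n)
    case 0
    then show ?case by (simp add: p0)
  next
    case (Suc n)
    let ?c = "h / (G * sqrt (real n + 2))"
    have "?c * (\<Sum>i<d. \<sigma> (p n) i) \<le> ?c * G"
      using assms sum_\<sigma> by (intro mult_left_mono) auto
    also have "\<dots> = h * (1 / sqrt (real n + 2))"
      using assms(2) by simp
    also have "\<dots> \<le> h * (2 * sqrt (real n + 1) - 2 * sqrt (real n))"
      using sqrt_increment_ge assms(3) by (intro mult_left_mono) auto
    finally have "?c * (\<Sum>i<d. \<sigma> (p n) i) \<le> 2 * h * sqrt (real (Suc n)) - 2 * h * sqrt (real n)"
      by (simp add: algebra_simps)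
    moreover have "(\<Sum>i<d. p (Suc n) i) = (\<Sum>i<d. p n i) - ?c * (\<Sum>i<d. \<sigma> (p n) i)"
      by (simp add: pS scaleR_fun_def sum_subtractf sum_distrib_left)
    ultimately show ?case
      using Suc.IH by linarith
  qed
  define x where "x k = p (k - 1)" for k
  define g where "g k = \<sigma> (x k)" for k
  have step: "adagrad_step d G h g k = h / (G * sqrt (real k + 1))" for k
  proof -
    have "G\<^sup>2 + (\<Sum>i = 1..k. (norm_Rn d (g i))\<^sup>2) = G\<^sup>2 * (real k + 1)"
      by (simp add: g_def norm_\<sigma> algebra_simps)
    then show ?thesis
      using assms(2) by (simp add: adagrad_step_def real_sqrt_mult)
  qed
  have "adagrad_run d (Rn d) (\<lambda>x. G * max_norm d x) G h N x g"
    unfolding adagrad_run_def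
  proof (intro conjI ballI)
    show "x 1 \<in> Rn d"
      using p_Rn by (simp add: x_def)
    fix k assume k: "k \<in> {1..N}"
    show "g k \<in> subdifferential d (\<lambda>x. G * max_norm d x) (x k)"
      using \<sigma>(1) by (simp add: g_def)
    obtain n where "k = Suc n"
      using k by (cases k) auto
    then have "x k - adagrad_step d G h g k *\<^sub>R g k = x (k + 1)"
      by (simp add: x_def g_def step pS add.commute)
    then show "x (k + 1) = proj_Rn d (Rn d) (x k - adagrad_step d G h g k *\<^sub>R g k)"
      using p_Rn by (simp add: proj_Rn_whole_space x_def)
  qed
  moreover have "x 1 = x1"
    by (simp add: x_def p0)
  moreover have "(\<Sum>i<d. x1 i) - 2 * h * sqrt (real N) \<le> real d * max_norm d (x (N + 1))"
    using sum_p[of N] sum_le_max_norm[of "p N" d] by (simp add: x_def)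
  ultimately show ?thesis
    using that by blast
qed

section \<open>The lower bound\<close>

lemma lower_bound_dim_ge_1: "lower_bound_dim \<gamma> N \<ge> 1"
  by (auto simp: lower_bound_dim_def le_nat_iff)

text \<open>The lower estimate makes the run of \<open>coordinate_run\<close> too short to reach the origin; the upper
  one turns \<open>1 / sqrt d\<close> into the minimum \<open>min (1 / a) 1\<close>. Rounding up costs \<open>1\<close>, and \<open>16 + 1\<close> stays
  below the square \<open>25\<close>.\<close>
lemma lower_bound_dim_bounds:
  assumes "\<gamma> > 1 / 4" "N \<ge> 1"
  defines "a \<equiv> real N powr (1 / 2 - \<gamma>)"
  shows "16 * a\<^sup>2 \<le> real (lower_bound_dim \<gamma> N)"
    and "real (lower_bound_dim \<gamma> N) \<le> (5 * max a 1)\<^sup>2"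
proof -
  have aa: "real N powr (1 - 2 * \<gamma>) = a\<^sup>2"
    by (simp add: a_def power2_eq_square powr_add[symmetric])
  have d: "real (lower_bound_dim \<gamma> N) = max (of_int \<lceil>16 * a\<^sup>2\<rceil>) 1"
    using assms(1) by (simp add: lower_bound_dim_def aa max_def)
  show "16 * a\<^sup>2 \<le> real (lower_bound_dim \<gamma> N)"
    unfolding d by linarith
  have m: "a\<^sup>2 \<le> (max a 1)\<^sup>2" "1 \<le> (max a 1)\<^sup>2"
    by (auto simp: a_def intro!: power_mono one_le_power)
  have "real (lower_bound_dim \<gamma> N) \<le> 16 * a\<^sup>2 + 1"
    unfolding d by (intro max.boundedI) (linarith, simp)
  also have "\<dots> \<le> 25 * (max a 1)\<^sup>2"
    using m by linarith
  also have "\<dots> = (5 * max a 1)\<^sup>2"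
    by (simp add: power_mult_distrib)
  finally show "real (lower_bound_dim \<gamma> N) \<le> (5 * max a 1)\<^sup>2" .
qed

theorem theorem4p4:
  shows "\<exists>c::real. c > 0 \<and>
    (\<forall>(\<gamma>::real) (N::nat) (G::real) (R::real). \<gamma> > 0 \<longrightarrow> N \<ge> 1 \<longrightarrow> G > 0 \<longrightarrow> R > 0 \<longrightarrow>
      (let d = lower_bound_dim \<gamma> N in
       \<exists>(X :: (nat \<Rightarrow> real) set) (f :: (nat \<Rightarrow> real) \<Rightarrow> real) (xstar :: nat \<Rightarrow> real)
         (x :: nat \<Rightarrow> nat \<Rightarrow> real) (g :: nat \<Rightarrow> nat \<Rightarrow> real).
         X \<noteq> {} \<and> closedin (Euclidean_space d) X \<and> convex X \<and>
         convex_on (Rn d) f \<and>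
         is_arg_min f (\<lambda>z. z \<in> X) xstar \<and>
         (\<forall>z\<in>X. \<forall>v\<in>subdifferential d f z. norm_Rn d v \<le> G) \<and>
         x 1 \<in> X \<and> norm_Rn d (x 1 - xstar) \<le> R \<and>
         adagrad_run d X f G (R / real N powr \<gamma>) N x g \<and>
         f (x (N + 1)) - f xstar \<ge>
           c * max (G * R / real N powr \<gamma>)
                   (min (G * R / real N powr (1 / 2 - \<gamma>)) (G * R))))"
proof (intro exI[of _ "1 / 10"] conjI allI impI)
  show "(0::real) < 1 / 10" by simp
  fix \<gamma> :: real and N :: nat and G R :: real
  assume \<gamma>: "\<gamma> > 0" and N: "N \<ge> 1" and G: "G > 0" and R: "R > 0"
  define d where "d = lower_bound_dim \<gamma> N"
  define h where "h = R / real N powr \<gamma>"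
  define a where "a = real N powr (1 / 2 - \<gamma>)"
  define B where "B = max (G * R / real N powr \<gamma>) (min (G * R / a) (G * R))"
  let ?f = "\<lambda>x. G * max_norm d x"
  have d1: "d \<ge> 1"
    using lower_bound_dim_ge_1 by (simp add: d_def)
  have pos: "h > 0" "a > 0" "real N powr \<gamma> \<ge> 1"
    using N R \<gamma> by (auto simp: h_def a_def ge_one_powr_ge_zero)
  have posN: "real N powr \<gamma> > 0"
    using pos(3) by linarith
  have GR: "G * R > 0"
    using G R by simp
  have "\<exists>x g. x 1 \<in> Rn d \<and> norm_Rn d (x 1 - 0) \<le> R \<and> adagrad_run d (Rn d) ?f G h N x g \<and>
      1 / 10 * B \<le> G * max_norm d (x (N + 1))"
  proof (cases "\<gamma> \<le> 1 / 4")
    case True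
    obtain x g where x: "x 1 = 0" "adagrad_run d (Rn d) ?f G h N x g"
      "G * h / sqrt 2 \<le> G * max_norm d (x (N + 1))"
      using late_kick_run[OF d1 G pos(1) N] .
    have "real N powr \<gamma> \<le> a"
      unfolding a_def using True N by (intro powr_mono) auto
    then have "G * R / a \<le> G * R / real N powr \<gamma>"
      using GR pos(2) posN by (intro divide_left_mono mult_pos_pos) linarith+
    then have "B = G * h"
      by (simp add: B_def h_def)
    moreover have "1 / 10 * (G * h) \<le> G * h / sqrt 2"
    proof -
      have "sqrt 2 \<le> 10"
        by (rule real_le_lsqrt) auto
      then have "G * h / 10 \<le> G * h / sqrt 2"
        using G pos by (intro divide_left_mono) auto
      then show ?thesis by simp
    qed
    ultimately have "1 / 10 * B \<le> G * max_norm d (x (N + 1))"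
      using x(3) by (metis order_trans)
    moreover have "norm_Rn d (x 1 - 0) \<le> R"
      using x(1) R by (simp add: norm_Rn_def L2_set_def)
    ultimately show ?thesis
      using x Rn_zero by metis
  next
    case False
    note bounds = lower_bound_dim_bounds[of \<gamma> N, folded a_def d_def]
    define x1 where "x1 = (\<lambda>i. if i < d then R / sqrt (real d) else 0)"
    have x1_Rn: "x1 \<in> Rn d"
      by (auto simp: Rn_iff x1_def)
    obtain x g where x: "x 1 = x1" "adagrad_run d (Rn d) ?f G h N x g"
      "(\<Sum>i<d. x1 i) - 2 * h * sqrt (real N) \<le> real d * max_norm d (x (N + 1))"
      using coordinate_run[OF d1 G pos(1) x1_Rn] .
    let ?q = "sqrt (real d)"
    have q: "?q > 0" "real d = ?q * ?q"
      using d1 by auto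
    have norm_x1: "norm_Rn d x1 = R"
      using q R d1 by (simp add: norm_Rn_def L2_set_def x1_def power_divide)
    have sum_x1: "(\<Sum>i<d. x1 i) = R * ?q"
      using q by (simp add: x1_def field_simps)
    have "h * sqrt (real N) = R * a"
      using N by (simp add: h_def a_def powr_diff powr_half_sqrt)
    moreover have "4 * a \<le> ?q"
      using bounds(1) False N pos by (intro real_le_rsqrt) (auto simp: power_mult_distrib)
    ultimately have "2 * h * sqrt (real N) \<le> R * ?q / 2"
      using mult_left_mono[of "4 * a" ?q R] R by simp
    then have "?q * (R / 2) \<le> real d * max_norm d (x (N + 1))"
      using x(3) sum_x1 by (simp add: algebra_simps)
    also have "\<dots> = ?q * (?q * max_norm d (x (N + 1)))"
      by (simp add: mult.assoc[symmetric])
    finally have "?q * (R / 2) \<le> ?q * (?q * max_norm d (x (N + 1)))" .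
    then have half: "R / 2 \<le> ?q * max_norm d (x (N + 1))"
      using q(1) mult_le_cancel_left_pos by blast
    have "?q \<le> 5 * max a 1"
      using bounds(2) False N by (intro real_le_lsqrt) auto
    then have "?q * max_norm d (x (N + 1)) \<le> 5 * max a 1 * max_norm d (x (N + 1))"
      using max_norm_nonneg[OF d1] by (rule mult_right_mono)
    then have "R / 10 \<le> max a 1 * max_norm d (x (N + 1))"
      using half by simp
    then have "R / 10 / max a 1 \<le> max_norm d (x (N + 1))"
      by (simp add: divide_le_eq mult_ac less_max_iff_disj)
    then have "G * (R / 10 / max a 1) \<le> G * max_norm d (x (N + 1))"
      using G by (intro mult_left_mono) auto
    moreover have "B = G * R / max a 1"
    proof -
      have "max a 1 \<le> real N powr \<gamma>"
        unfolding a_def using False N pos(3) by (auto intro!: powr_mono)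
      then have "G * R / real N powr \<gamma> \<le> G * R / max a 1"
        using GR posN by (intro divide_left_mono mult_pos_pos) auto
      moreover have "min (G * R / a) (G * R) = G * R / max a 1"
        using GR pos divide_left_mono[of a 1 "G * R"] divide_left_mono[of 1 a "G * R"]
        by (cases "a \<le> 1") (auto simp: min_def max_def)
      ultimately show ?thesis
        by (simp add: B_def)
    qed
    ultimately have "1 / 10 * B \<le> G * max_norm d (x (N + 1))"
      by simp
    moreover have "norm_Rn d (x 1 - 0) \<le> R"
      using x(1) norm_x1 by (simp add: fun_diff_def)
    ultimately show ?thesis
      using x x1_Rn by metis
  qed
  then obtain x g where x: "x 1 \<in> Rn d" "norm_Rn d (x 1 - 0) \<le> R"
    "adagrad_run d (Rn d) ?f G h N x g" "1 / 10 * B \<le> G * max_norm d (x (N + 1))"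
    by blast
  have fx: "?f (x (N + 1)) - ?f 0 \<ge> 1 / 10 * B"
    using x(4) d1 by (simp add: max_norm_zero)
  show "let d = lower_bound_dim \<gamma> N in
       \<exists>(X :: (nat \<Rightarrow> real) set) (f :: (nat \<Rightarrow> real) \<Rightarrow> real) (xstar :: nat \<Rightarrow> real)
         (x :: nat \<Rightarrow> nat \<Rightarrow> real) (g :: nat \<Rightarrow> nat \<Rightarrow> real).
         X \<noteq> {} \<and> closedin (Euclidean_space d) X \<and> convex X \<and>
         convex_on (Rn d) f \<and>
         is_arg_min f (\<lambda>z. z \<in> X) xstar \<and>
         (\<forall>z\<in>X. \<forall>v\<in>subdifferential d f z. norm_Rn d v \<le> G) \<and>
         x 1 \<in> X \<and> norm_Rn d (x 1 - xstar) \<le> R \<and>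
         adagrad_run d X f G (R / real N powr \<gamma>) N x g \<and>
         f (x (N + 1)) - f xstar \<ge>
           1 / 10 * max (G * R / real N powr \<gamma>)
                   (min (G * R / real N powr (1 / 2 - \<gamma>)) (G * R))"
    unfolding Let_def d_def[symmetric] h_def[symmetric] a_def[symmetric] B_def[symmetric]
  proof (intro exI conjI)
    show "Rn d \<noteq> {}"
      using Rn_zero by blast
    show "closedin (Euclidean_space d) (Rn d)"
      by (rule closedin_topspace)
    show "is_arg_min ?f (\<lambda>z. z \<in> Rn d) 0"
      using zero_is_arg_min d1 G by simp
    show "\<forall>z\<in>Rn d. \<forall>v\<in>subdifferential d ?f z. norm_Rn d v \<le> G"
      using norm_subgradient_max_norm_le[OF d1] G by simp
  qed (use x fx convex_Rn convex_on_max_norm[OF d1] G in auto)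
qed

end
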